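(* Let $D, M \ge 1$, let $B_j \in \mathbb{R}^{M \times D}$, and let $t_j \in \mathbb{R}^D$ with $t_j \neq 0$. For $\gamma > 0$ define $$d_j(\gamma) = \left(\tfrac{1}{M} B_j^\top B_j + \gamma I_D\right)^{-1} t_j .$$ Then for every $v_j \in \mathbb{R}^D$, as $\gamma \to \infty$, the CARE update $$v_j - \delta\big(\cos(t_j, v_j)\big)\,\frac{\langle d_j(\gamma), v_j\rangle}{\langle d_j(\gamma), d_j(\gamma)\rangle}\, d_j(\gamma)$$ converges to the raw value-space erasure update with direction $t_j$, $$v_j - \delta\big(\cos(t_j, v_j)\big)\,\frac{\langle t_j, v_j\rangle}{\langle t_j, t_j\rangle}\, t_j .$$
   Context: $\langle\cdot,\cdot\rangle$ is the standard Euclidean inner product on $\mathbb{R}^D$, $\|\cdot\|$ its norm, and $I_D$ the $D\times D$ identity matrix. The cosine similarity is $\cos(t,v) = \langle t,v\rangle/(\|t\|\,\|v\|)$ (set to $0$ if $t$ or $v$ is zero). The gate is the function $\delta(x) = \dfrac{s}{1+\exp\{-p(x-\epsilon)\}}$ with fixed real parameters $s, p, \epsilon$; it does not depend on $\gamma$. The rows of $B_j$ are the value vectors of $M$ retained anchors and $t_j$ is the target value vector; the subscript $j$ is a fixed token position and plays no role. *)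

theory Defs
  imports "HOL-Analysis.Analysis"
begin

definition cosine_similarity :: "real ^ 'd \<Rightarrow> real ^ 'd \<Rightarrow> real" where
  "cosine_similarity t v =
     (if t = 0 \<or> v = 0 then 0 else (t \<bullet> v) / (norm t * norm v))"

definition gate :: "real \<Rightarrow> real \<Rightarrow> real \<Rightarrow> real \<Rightarrow> real" where
  "gate s p \<epsilon> x = s / (1 + exp (- p * (x - \<epsilon>)))"

(* The rows of B are indexed by 'm and the coordinates of the value space by 'd,
   so that CARD('m) is M and CARD('d) is D; both are at least 1. *)
definition care_direction ::
  "real ^ 'd ^ 'm \<Rightarrow> real ^ 'd \<Rightarrow> real \<Rightarrow> real ^ 'd" where
  "care_direction B t \<gamma> =
     matrix_inv ((1 / real CARD('m)) *\<^sub>R (transpose B ** B) + \<gamma> *\<^sub>R mat 1) *v t"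

(* Erasure of v along d. The gate always takes the similarity of v to the target t,
   also when the direction d is not t. The raw update is the case d = t. *)
definition erasure_update ::
  "real \<Rightarrow> real \<Rightarrow> real \<Rightarrow> real ^ 'd \<Rightarrow> real ^ 'd \<Rightarrow> real ^ 'd \<Rightarrow> real ^ 'd" where
  "erasure_update s p \<epsilon> t d v =
     v - (gate s p \<epsilon> (cosine_similarity t v) * ((d \<bullet> v) / (d \<bullet> d))) *\<^sub>R d"

end

theory Submission
  imports Defs
begin

text \<open>The update is unchanged when the direction is rescaled, so \<open>d(\<gamma>)\<close> may be replaced by
  \<open>\<gamma> d(\<gamma>)\<close>. Pairing \<open>(A + \<gamma> I) d = t\<close> with \<open>d\<close>, where \<open>A\<close> is positive semidefinite, gives
  \<open>\<gamma> \<parallel>d\<parallel> \<le> \<parallel>t\<parallel>\<close>; hence \<open>\<gamma> d - t = - A d\<close> tends to \<open>0\<close>, and the update is continuous in the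
  direction at \<open>t \<noteq> 0\<close>.\<close>

lemma inner_transpose_mult_self:
  fixes B :: "real ^ 'd ^ 'm"
  shows "((transpose B ** B) *v x) \<bullet> x = (norm (B *v x))\<^sup>2"
  by (simp add: dot_lmul_matrix power2_norm_eq_inner flip: matrix_vector_mul_assoc)

lemma shifted_matrix_vector_mult:
  fixes A :: "real ^ 'd ^ 'd"
  shows "(A + \<gamma> *\<^sub>R mat 1) *v x = A *v x + \<gamma> *\<^sub>R x"
  by (simp add: matrix_vector_mult_add_rdistrib flip: scaleR_matrix_vector_assoc)

text \<open>\<open>matrix_inv\<close> is a Hilbert choice of a two-sided inverse; invertibility
  makes the choice meaningful.\<close>

lemma matrix_mult_matrix_inv:
  fixes A :: "'a::semiring_1 ^ 'n ^ 'm"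
  assumes "invertible A"
  shows "A ** matrix_inv A = mat 1"
  using someI_ex[OF assms[unfolded invertible_def]] by (simp add: matrix_inv_def)

text \<open>Pair with \<open>x\<close> and cancel one factor \<open>norm x\<close> after
  Cauchy-Schwarz. The bound serves twice: for the trivial kernel and for the decay of the
  direction.\<close>

lemma norm_shifted_psd_ge:
  fixes A :: "real ^ 'd ^ 'd"
  assumes "\<And>x. (A *v x) \<bullet> x \<ge> 0"
  shows "\<gamma> * norm x \<le> norm ((A + \<gamma> *\<^sub>R mat 1) *v x)"
proof (cases "x = 0")
  case False
  have "(\<gamma> * norm x) * norm x = (\<gamma> *\<^sub>R x) \<bullet> x"
    by (simp add: dot_square_norm power2_eq_square)
  also have "\<dots> \<le> ((A + \<gamma> *\<^sub>R mat 1) *v x) \<bullet> x"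
    using assms[of x] by (simp add: shifted_matrix_vector_mult inner_add_left)
  also have "\<dots> \<le> norm ((A + \<gamma> *\<^sub>R mat 1) *v x) * norm x"
    by (rule norm_cauchy_schwarz)
  finally show ?thesis
    using False by simp
qed simp

text \<open>The lower bound forces a trivial kernel, which suffices for a square matrix.\<close>

lemma invertible_shifted_psd:
  fixes A :: "real ^ 'd ^ 'd"
  assumes "\<And>x. (A *v x) \<bullet> x \<ge> 0" and "\<gamma> > 0"
  shows "invertible (A + \<gamma> *\<^sub>R mat 1)"
proof -
  have "x = 0" if "(A + \<gamma> *\<^sub>R mat 1) *v x = 0" for x
    using norm_shifted_psd_ge[OF assms(1), of \<gamma> x] that \<open>\<gamma> > 0\<close>
    by (simp add: mult_le_0_iff)
  then show ?thesis
    unfolding invertible_left_inverse matrix_left_invertible_ker by blast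
qed

lemma tendsto_scaled_resolvent:
  fixes A :: "real ^ 'd ^ 'd"
  assumes psd: "\<And>x. (A *v x) \<bullet> x \<ge> 0"
  shows "((\<lambda>\<gamma>. \<gamma> *\<^sub>R (matrix_inv (A + \<gamma> *\<^sub>R mat 1) *v t)) \<longlongrightarrow> t) at_top"
proof -
  define d where "d \<gamma> = matrix_inv (A + \<gamma> *\<^sub>R mat 1) *v t" for \<gamma>
  have solves: "(A + \<gamma> *\<^sub>R mat 1) *v d \<gamma> = t" if "\<gamma> > 0" for \<gamma>
    using invertible_shifted_psd[OF psd that]
    by (simp add: d_def matrix_vector_mul_assoc matrix_mult_matrix_inv)
  have "norm (d \<gamma>) \<le> norm t / \<gamma>" if "\<gamma> > 0" for \<gamma>
    using norm_shifted_psd_ge[OF psd, of \<gamma> "d \<gamma>"] solves[OF that] that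
    by (simp add: pos_le_divide_eq mult.commute)
  then have "eventually (\<lambda>\<gamma>. norm (d \<gamma>) \<le> norm t / \<gamma>) at_top"
    by (rule eventually_mono[OF eventually_gt_at_top])
  moreover have "((\<lambda>\<gamma>. norm t / \<gamma>) \<longlongrightarrow> 0) at_top"
    by (intro tendsto_divide_0[OF tendsto_const] filterlim_at_top_imp_at_infinity filterlim_ident)
  ultimately have "(d \<longlongrightarrow> 0) at_top"
    by (rule Lim_null_comparison)
  then have "((\<lambda>\<gamma>. t - A *v d \<gamma>) \<longlongrightarrow> t - A *v 0) at_top"
    by (intro tendsto_intros
        bounded_linear.tendsto[OF matrix_vector_mul_bounded_linear])
  \<comment> \<open>The equation for \<open>d \<gamma>\<close> was established for positive
    \<open>\<gamma>\<close>, hence eventually.\<close>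
  moreover have "eventually (\<lambda>\<gamma>. t - A *v d \<gamma> = \<gamma> *\<^sub>R d \<gamma>) at_top"
    using eventually_gt_at_top[of 0]
  proof eventually_elim
    case (elim \<gamma>)
    show ?case
      using solves[OF elim, unfolded shifted_matrix_vector_mult]
      by (simp add: algebra_simps)
  qed
  ultimately show ?thesis
    by (simp add: d_def tendsto_cong)
qed

text \<open>The inner product with \<open>v\<close> and the direction each gain a factor
  \<open>c\<close>, which the \<open>c * c\<close> in the denominator cancels.\<close>

lemma erasure_update_scaleR:
  assumes "c \<noteq> 0"
  shows "erasure_update s p \<epsilon> t (c *\<^sub>R d) v = erasure_update s p \<epsilon> t d v"
  using assms by (simp add: erasure_update_def)

text \<open>The gate depends on \<open>t\<close> and \<open>v\<close> alone, so it stays constant;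
  \<open>d \<noteq> 0\<close> keeps the limiting denominator nonzero.\<close>

lemma tendsto_erasure_update:
  assumes "(f \<longlongrightarrow> d) F" and "d \<noteq> 0"
  shows "((\<lambda>x. erasure_update s p \<epsilon> t (f x) v) \<longlongrightarrow> erasure_update s p \<epsilon> t d v) F"
  unfolding erasure_update_def using assms by (intro tendsto_intros) auto

theorem proposition2:
  fixes B :: "real ^ 'd ^ 'm" and t v :: "real ^ 'd" and s p \<epsilon> :: real
  assumes "t \<noteq> 0"
  shows "((\<lambda>\<gamma>. erasure_update s p \<epsilon> t (care_direction B t \<gamma>) v)
           \<longlongrightarrow> erasure_update s p \<epsilon> t t v) at_top"
proof -
  \<comment> \<open>The quadratic form equals \<open>(norm (B *v x))\<^sup>2\<close> divided by
    \<open>CARD('m)\<close>.\<close>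
  have "(((1 / real CARD('m)) *\<^sub>R (transpose B ** B)) *v x) \<bullet> x \<ge> 0" for x
    by (simp add: inner_transpose_mult_self flip: scaleR_matrix_vector_assoc)
  then have "((\<lambda>\<gamma>. \<gamma> *\<^sub>R care_direction B t \<gamma>) \<longlongrightarrow> t) at_top"
    unfolding care_direction_def by (rule tendsto_scaled_resolvent)
  then have "((\<lambda>\<gamma>. erasure_update s p \<epsilon> t (\<gamma> *\<^sub>R care_direction B t \<gamma>) v)
      \<longlongrightarrow> erasure_update s p \<epsilon> t t v) at_top"
    using assms by (rule tendsto_erasure_update)
  moreover have "eventually (\<lambda>\<gamma>. erasure_update s p \<epsilon> t (\<gamma> *\<^sub>R care_direction B t \<gamma>) v
      = erasure_update s p \<epsilon> t (care_direction B t \<gamma>) v) at_top"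
    using eventually_gt_at_top[of 0]
    by eventually_elim (simp add: erasure_update_scaleR)
  ultimately show ?thesis
    by (simp add: tendsto_cong)
qed

end
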